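(* Let $\mathcal{H}$ be a separable Hilbert space, $I$ a countable index set, and $\varphi=\{\varphi_i\}_{i\in I}$ a redundant frame for $\mathcal{H}$ with frame bounds $0<A_\varphi\le B_\varphi<\infty$ and frame operator $S_\varphi$. Suppose that $$\Vert I_{\mathcal{H}}-S_\varphi^{-1}\Vert^2<\frac{A_\varphi}{B_\varphi}.$$ Then $\varphi$ has infinitely many dual frames $\{\psi_i\}_{i\in I}$ for which $\{\varphi_i\}_{i\in I}$ and $\{\psi_i\}_{i\in I}$ are woven.
   Context: A family $\{\varphi_i\}_{i\in I}$ in $\mathcal{H}$ is a frame with frame bounds $0<A_\varphi\le B_\varphi<\infty$ if $A_\varphi\Vert f\Vert^2\le\sum_{i\in I}|\langle f,\varphi_i\rangle|^2\le B_\varphi\Vert f\Vert^2$ for all $f\in\mathcal{H}$. The frame operator is $S_\varphi f=\sum_{i\in I}\langle f,\varphi_i\rangle\varphi_i$, which is bounded, invertible and self-adjoint. A frame is redundant if it is not a Riesz basis; equivalently, its synthesis operator $T_\varphi:\ell^2(I)\to\mathcal{H}$, $T_\varphi\{c_i\}=\sum_{i\in I} c_i\varphi_i$, has nontrivial kernel. A frame $\{\psi_i\}_{i\in I}$ for $\mathcal{H}$ is a dual frame of $\varphi$ if $f=\sum_{i\in I}\langle f,\psi_i\rangle\varphi_i$ for all $f\in\mathcal{H}$. Two frames $\{\varphi_i\}_{i\in I}$ and $\{\psi_i\}_{i\in I}$ for $\mathcal{H}$ are woven if there are constants $0<A\le B<\infty$ such that for every $J\subseteq I$ the family $\{\varphi_i\}_{i\in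 J}\cup\{\psi_i\}_{i\in J^c}$ (with $J^c=I\setminus J$, counted with indices) is a frame for $\mathcal{H}$ with bounds $A$ and $B$. $I_{\mathcal{H}}$ is the identity operator on $\mathcal{H}$. *)

theory Defs
  imports "HOL-Analysis.Analysis"
begin

text \<open>
  The scalar field of a Hilbert space is the real or the complex numbers. Both are instances of
  the class below, and (by the Gelfand-Mazur theorem) they are its only models up to isometric
  isomorphism; the last axiom forces \<open>sconj\<close> to be the identity, respectively complex conjugation.
\<close>

class scalar_field = real_normed_field +
  fixes sconj :: "'a \<Rightarrow> 'a"
  assumes sconj_add: "sconj (x + y) = sconj x + sconj y"
    and sconj_mult: "sconj (x * y) = sconj x * sconj y"
    and mult_sconj: "x * sconj x = (norm x)\<^sup>2 *\<^sub>R 1"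

instantiation real :: scalar_field
begin
definition sconj_real :: "real \<Rightarrow> real" where "sconj_real x = x"
instance by standard (simp_all add: sconj_real_def power2_eq_square)
end

instantiation complex :: scalar_field
begin
definition sconj_complex :: "complex \<Rightarrow> complex" where "sconj_complex z = cnj z"
instance by standard (simp_all add: sconj_complex_def complex_norm_square[symmetric] scaleR_conv_of_real)
end

text \<open>
  Completeness is the sort \<open>banach\<close> of the vectors; \<open>ip_self\<close> says that their norm is the one
  given by the inner product, which also makes \<open>ip\<close> positive definite.
\<close>

locale hilbert_space = vector_space smul
  for smul :: "'k::scalar_field \<Rightarrow> 'h::banach \<Rightarrow> 'h" +
  fixes ip :: "'h \<Rightarrow> 'h \<Rightarrow> 'k"
  assumes smul_of_real: "smul (of_real r) x = r *\<^sub>R x"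
    and ip_add_left: "ip (x + y) z = ip x z + ip y z"
    and ip_smul_left: "ip (smul c x) y = c * ip x y"
    and ip_commute: "ip y x = sconj (ip x y)"
    and ip_self: "ip x x = of_real ((norm x)\<^sup>2)"

lemma hilbert_space_real:
  "hilbert_space scaleR (inner :: 'h::{banach, real_inner} \<Rightarrow> 'h \<Rightarrow> real)"
  by unfold_locales
    (simp_all add: inner_add_left inner_commute sconj_real_def power2_norm_eq_inner algebra_simps)

lemma hilbert_space_complex: "hilbert_space (*) (\<lambda>x y :: complex. x * cnj y)"
  by unfold_locales
    (simp_all add: algebra_simps sconj_complex_def scaleR_conv_of_real flip: complex_norm_square)

text \<open>
  A family indexed by \<open>I\<close> is a function whose values outside \<open>I\<close> are irrelevant. Summability is
  required explicitly because \<open>infsum\<close> is \<open>0\<close> on non-summable functions.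
\<close>

definition frame_with_bounds ::
    "('h::banach \<Rightarrow> 'h \<Rightarrow> 'k::scalar_field) \<Rightarrow> 'i set \<Rightarrow> ('i \<Rightarrow> 'h) \<Rightarrow> real \<Rightarrow> real \<Rightarrow> bool" where
  "frame_with_bounds ip I \<phi> A B \<longleftrightarrow> 0 < A \<and> A \<le> B \<and>
     (\<forall>f. (\<lambda>i. (norm (ip f (\<phi> i)))\<^sup>2) summable_on I \<and>
          A * (norm f)\<^sup>2 \<le> (\<Sum>\<^sub>\<infinity>i\<in>I. (norm (ip f (\<phi> i)))\<^sup>2) \<and>
          (\<Sum>\<^sub>\<infinity>i\<in>I. (norm (ip f (\<phi> i)))\<^sup>2) \<le> B * (norm f)\<^sup>2)"

definition is_frame ::
    "('h::banach \<Rightarrow> 'h \<Rightarrow> 'k::scalar_field) \<Rightarrow> 'i set \<Rightarrow> ('i \<Rightarrow> 'h) \<Rightarrow> bool" where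
  "is_frame ip I \<phi> \<longleftrightarrow> (\<exists>A B. frame_with_bounds ip I \<phi> A B)"

definition frame_operator ::
    "('k::scalar_field \<Rightarrow> 'h::banach \<Rightarrow> 'h) \<Rightarrow> ('h \<Rightarrow> 'h \<Rightarrow> 'k) \<Rightarrow> 'i set \<Rightarrow> ('i \<Rightarrow> 'h) \<Rightarrow> 'h \<Rightarrow> 'h" where
  "frame_operator smul ip I \<phi> f = (\<Sum>\<^sub>\<infinity>i\<in>I. smul (ip f (\<phi> i)) (\<phi> i))"

text \<open>
  A Riesz basis is a complete family satisfying the two-sided \<open>\<ell>\<^sup>2\<close> estimate on all finitely
  supported coefficient families (\<open>F\<close> contains the support).
\<close>

definition riesz_basis ::
    "('k::scalar_field \<Rightarrow> 'h::banach \<Rightarrow> 'h) \<Rightarrow> 'i set \<Rightarrow> ('i \<Rightarrow> 'h) \<Rightarrow> bool" where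
  "riesz_basis smul I \<phi> \<longleftrightarrow> closure (module.span smul (\<phi> ` I)) = UNIV \<and>
     (\<exists>A B. 0 < A \<and> A \<le> B \<and>
        (\<forall>F c. finite F \<and> F \<subseteq> I \<longrightarrow>
           A * (\<Sum>i\<in>F. (norm (c i))\<^sup>2) \<le> (norm (\<Sum>i\<in>F. smul (c i) (\<phi> i)))\<^sup>2 \<and>
           (norm (\<Sum>i\<in>F. smul (c i) (\<phi> i)))\<^sup>2 \<le> B * (\<Sum>i\<in>F. (norm (c i))\<^sup>2)))"

definition redundant_frame ::
    "('k::scalar_field \<Rightarrow> 'h::banach \<Rightarrow> 'h) \<Rightarrow> ('h \<Rightarrow> 'h \<Rightarrow> 'k) \<Rightarrow> 'i set \<Rightarrow> ('i \<Rightarrow> 'h) \<Rightarrow> bool" where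
  "redundant_frame smul ip I \<phi> \<longleftrightarrow> is_frame ip I \<phi> \<and> \<not> riesz_basis smul I \<phi>"

definition dual_frame ::
    "('k::scalar_field \<Rightarrow> 'h::banach \<Rightarrow> 'h) \<Rightarrow> ('h \<Rightarrow> 'h \<Rightarrow> 'k) \<Rightarrow> 'i set
      \<Rightarrow> ('i \<Rightarrow> 'h) \<Rightarrow> ('i \<Rightarrow> 'h) \<Rightarrow> bool" where
  "dual_frame smul ip I \<phi> \<psi> \<longleftrightarrow> is_frame ip I \<psi> \<and>
     (\<forall>f. ((\<lambda>i. smul (ip f (\<psi> i)) (\<phi> i)) has_sum f) I)"

definition woven ::
    "('h::banach \<Rightarrow> 'h \<Rightarrow> 'k::scalar_field) \<Rightarrow> 'i set \<Rightarrow> ('i \<Rightarrow> 'h) \<Rightarrow> ('i \<Rightarrow> 'h) \<Rightarrow> bool" where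
  "woven ip I \<phi> \<psi> \<longleftrightarrow> is_frame ip I \<phi> \<and> is_frame ip I \<psi> \<and>
     (\<exists>A B. \<forall>J\<subseteq>I. frame_with_bounds ip I (\<lambda>i. if i \<in> J then \<phi> i else \<psi> i) A B)"

end

(*
  Write S for the frame operator, T for the synthesis operator and e for the norm of id - S^-1.
  The coefficients of f with respect to phi and to the canonical dual S^-1 phi are <f, phi_i> and
  <S^-1 f, phi_i>, so they differ in l^2 by at most sqrt B * e * |f|. Every weaving of the two
  therefore keeps the lower bound (sqrt A - sqrt B * e)^2 > 0. This gap survives small
  perturbations of the dual: redundancy provides 0 \<noteq> d in ker T, and for a fixed vector h all
  S^-1 phi_i + t conj(d_i) h with small t > 0 are distinct dual frames woven with phi.
*)

theory Submission
  imports Defs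
begin

section \<open>Conjugation on the scalar field\<close>

lemma norm_sconj [simp]: "norm (sconj x) = norm (x :: 'k::scalar_field)"
proof (cases "x = 0")
  case True
  \<comment> \<open>At 0 the axiom \<open>mult_sconj\<close> says nothing about
    \<open>sconj 0\<close>, so additivity has to settle this case.\<close>
  have "sconj (0 + 0) = sconj (0::'k) + sconj 0"
    by (rule sconj_add)
  then show ?thesis
    using True by simp
next
  case False
  have "norm x * norm (sconj x) = norm ((norm x)\<^sup>2 *\<^sub>R (1::'k))"
    by (metis mult_sconj norm_mult)
  then show ?thesis
    using False by (simp add: power2_eq_square)
qed

lemma sconj_zero [simp]: "sconj (0 :: 'k::scalar_field) = 0"
  by (metis norm_eq_zero norm_sconj)

lemma mult_sconj_of_real: "x * sconj x = of_real ((norm x)\<^sup>2)" for x :: "'k::scalar_field"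
  by (simp add: mult_sconj of_real_def)

lemma sconj_of_real [simp]: "sconj (of_real r) = (of_real r :: 'k::scalar_field)"
proof (cases "r = 0")
  case False
  have "of_real r * sconj (of_real r :: 'k) = of_real r * of_real r"
    by (simp add: mult_sconj_of_real power2_eq_square)
  then show ?thesis
    using False by simp
qed simp

lemma sconj_sconj [simp]: "sconj (sconj x) = (x :: 'k::scalar_field)"
proof (cases "x = 0")
  case False
  have "sconj x * sconj (sconj x) = sconj x * x"
    by (metis mult.commute mult_sconj norm_sconj)
  moreover have "sconj x \<noteq> 0"
    using False by (metis norm_eq_zero norm_sconj)
  ultimately show ?thesis
    by simp
qed simp

text \<open>Cauchy criterion for the net of finite partial sums: a finite sum containing
  \<open>G\<close> differs from the sum over \<open>G\<close> by a tail. The norm is taken after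
  summation because the synthesis series need not converge absolutely.\<close>

lemma summable_on_vanishing_tails:
  fixes f :: "'i \<Rightarrow> 'b::banach"
  assumes tails: "\<And>e. e > 0 \<Longrightarrow>
    \<exists>G. finite G \<and> G \<subseteq> A \<and> (\<forall>F. finite F \<longrightarrow> F \<subseteq> A - G \<longrightarrow> norm (sum f F) < e)"
  shows "f summable_on A"
proof -
  have "\<exists>P. eventually P (finite_subsets_at_top A) \<and>
          (\<forall>F F'. P F \<and> P F' \<longrightarrow> dist (sum f F) (sum f F') < e)" if e: "e > 0" for e
  proof -
    obtain G where G: "finite G" "G \<subseteq> A"
      and small: "\<And>F. finite F \<Longrightarrow> F \<subseteq> A - G \<Longrightarrow> norm (sum f F) < e / 2"
      using tails[OF half_gt_zero[OF e]] by blast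
    define P where "P F \<longleftrightarrow> finite F \<and> G \<subseteq> F \<and> F \<subseteq> A" for F
    have "eventually P (finite_subsets_at_top A)"
      unfolding eventually_finite_subsets_at_top P_def using G by blast
    moreover have close: "dist (sum f F) (sum f G) < e / 2" if "P F" for F
    proof -
      have "sum f F - sum f G = sum f (F - G)"
        using that G by (simp add: P_def sum_diff)
      then show ?thesis
        using small[of "F - G"] that by (auto simp: dist_norm P_def)
    qed
    moreover have "dist (sum f F) (sum f F') < e" if "P F" "P F'" for F F'
      using close[OF that(1)] close[OF that(2)] dist_triangle_half_l by metis
    ultimately show ?thesis
      by blast
  qed
  then have "cauchy_filter (filtermap (sum f) (finite_subsets_at_top A))"
    by (simp add: cauchy_filter_metric_filtermap)
  then obtain L where "(sum f \<longlongrightarrow> L) (finite_subsets_at_top A)"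
    using complete_uniform[where S = "UNIV :: 'b set"] complete_UNIV
    by (force simp add: filterlim_def)
  then show ?thesis
    using summable_on_def has_sum_def by blast
qed

section \<open>Square-summable families\<close>

definition l2 :: "'i set \<Rightarrow> ('i \<Rightarrow> 'a::real_normed_vector) \<Rightarrow> bool" where
  "l2 I a \<longleftrightarrow> (\<lambda>i. (norm (a i))\<^sup>2) summable_on I"

text \<open>As \<open>infsum\<close> is 0 on non-summable families, a bound on this value means
  something only together with \<open>l2\<close>; the estimates below therefore come in
  pairs.\<close>

definition l2norm :: "'i set \<Rightarrow> ('i \<Rightarrow> 'a::real_normed_vector) \<Rightarrow> real" where
  "l2norm I a = sqrt (\<Sum>\<^sub>\<infinity>i\<in>I. (norm (a i))\<^sup>2)"

lemma l2norm_nonneg [simp]: "0 \<le> l2norm I a"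
  by (simp add: l2norm_def infsum_nonneg)

lemma l2norm_power2: "(l2norm I a)\<^sup>2 = (\<Sum>\<^sub>\<infinity>i\<in>I. (norm (a i))\<^sup>2)"
  by (simp add: l2norm_def infsum_nonneg)

lemma L2_set_le_l2norm:
  assumes "l2 I a" "finite F" "F \<subseteq> I"
  shows "L2_set (\<lambda>i. norm (a i)) F \<le> l2norm I a"
  unfolding L2_set_def l2norm_def
  using assms by (auto simp: l2_def intro!: finite_sum_le_infsum)

text \<open>A common bound on all finite sections yields membership and the norm bound at once,
  which reduces the infinite triangle inequality to the finite one for
  \<open>L2_set\<close>.\<close>

lemma l2_of_L2_set_le:
  assumes "\<And>F. finite F \<Longrightarrow> F \<subseteq> I \<Longrightarrow> L2_set (\<lambda>i. norm (a i)) F \<le> C"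
  shows "l2 I a" "l2norm I a \<le> C"
proof -
  have C: "0 \<le> C"
    using assms[of "{}"] by simp
  have bound: "(\<Sum>i\<in>F. (norm (a i))\<^sup>2) \<le> C\<^sup>2" if "finite F" "F \<subseteq> I" for F
    using assms[OF that] C by (simp add: L2_set_def sqrt_le_D)
  show *: "l2 I a"
    unfolding l2_def by (rule nonneg_bdd_above_summable_on) (auto intro!: bdd_aboveI2 bound)
  have "(\<Sum>\<^sub>\<infinity>i\<in>I. (norm (a i))\<^sup>2) \<le> C\<^sup>2"
    using * bound by (intro infsum_le_finite_sums) (auto simp: l2_def)
  then show "l2norm I a \<le> C"
    unfolding l2norm_def using C by (intro real_le_lsqrt) (simp_all add: infsum_nonneg)
qed

lemma l2_add:
  assumes "l2 I a" "l2 I b"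
  shows "l2 I (\<lambda>i. a i + b i)" "l2norm I (\<lambda>i. a i + b i) \<le> l2norm I a + l2norm I b"
proof -
  have "L2_set (\<lambda>i. norm (a i + b i)) F \<le> l2norm I a + l2norm I b" if "finite F" "F \<subseteq> I" for F
  proof -
    have "L2_set (\<lambda>i. norm (a i + b i)) F \<le> L2_set (\<lambda>i. norm (a i) + norm (b i)) F"
      by (intro L2_set_mono norm_triangle_ineq) simp
    also have "\<dots> \<le> L2_set (\<lambda>i. norm (a i)) F + L2_set (\<lambda>i. norm (b i)) F"
      by (rule L2_set_triangle_ineq)
    also have "\<dots> \<le> l2norm I a + l2norm I b"
      using L2_set_le_l2norm assms that by (metis add_mono)
    finally show ?thesis .
  qed
  then show "l2 I (\<lambda>i. a i + b i)" "l2norm I (\<lambda>i. a i + b i) \<le> l2norm I a + l2norm I b"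
    using l2_of_L2_set_le[of I "\<lambda>i. a i + b i"] by blast+
qed

lemma l2_dominated:
  assumes "l2 I b" "\<And>i. i \<in> I \<Longrightarrow> norm (a i) \<le> norm (b i)"
  shows "l2 I a" "l2norm I a \<le> l2norm I b"
proof -
  have "L2_set (\<lambda>i. norm (a i)) F \<le> l2norm I b" if "finite F" "F \<subseteq> I" for F
  proof -
    have "L2_set (\<lambda>i. norm (a i)) F \<le> L2_set (\<lambda>i. norm (b i)) F"
      using assms(2) that by (intro L2_set_mono) auto
    then show ?thesis
      using L2_set_le_l2norm[OF assms(1) that] by simp
  qed
  then show "l2 I a" "l2norm I a \<le> l2norm I b"
    using l2_of_L2_set_le[of I a] by blast+
qed

lemma l2_scale:
  fixes a :: "'i \<Rightarrow> 'a::real_normed_field"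
  assumes "l2 I a"
  shows "l2 I (\<lambda>i. k * a i)" "l2norm I (\<lambda>i. k * a i) = norm k * l2norm I a"
  using assms
  by (auto simp: l2_def l2norm_def norm_mult power_mult_distrib infsum_cmult_right'
      real_sqrt_mult intro: summable_on_cmult_right)

lemma l2_cong: "(\<And>i. i \<in> I \<Longrightarrow> a i = b i) \<Longrightarrow> l2 I a = l2 I b"
  unfolding l2_def by (intro summable_on_cong) simp

lemma l2norm_cong: "(\<And>i. i \<in> I \<Longrightarrow> a i = b i) \<Longrightarrow> l2norm I a = l2norm I b"
  unfolding l2norm_def by (metis (mono_tags, lifting) infsum_cong)

text \<open>Unsquared estimates combine by the triangle inequality without cross terms, so squaring
  is postponed to this point.\<close>

lemma frame_with_bounds_l2:
  assumes "0 < A" "A \<le> B"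
    and "\<And>f. l2 I (\<lambda>i. ip f (\<phi> i))"
    and lower: "\<And>f. A * norm f \<le> l2norm I (\<lambda>i. ip f (\<phi> i))"
    and upper: "\<And>f. l2norm I (\<lambda>i. ip f (\<phi> i)) \<le> B * norm f"
  shows "frame_with_bounds ip I \<phi> (A\<^sup>2) (B\<^sup>2)"
  unfolding frame_with_bounds_def l2norm_power2[symmetric] power_mult_distrib[symmetric]
  using assms by (auto simp: l2_def intro!: power_mono)

section \<open>Hilbert space geometry\<close>

context hilbert_space
begin

lemma ip_scaleR_left: "ip (r *\<^sub>R x) y = r *\<^sub>R ip x y"
  by (metis smul_of_real ip_smul_left scaleR_conv_of_real)

lemma ip_add_right: "ip x (y + z) = ip x y + ip x z"
  by (metis ip_commute ip_add_left sconj_add)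

lemma ip_smul_right: "ip x (smul c y) = sconj c * ip x y"
  by (metis ip_commute ip_smul_left sconj_mult)

lemma ip_scaleR_right: "ip x (r *\<^sub>R y) = r *\<^sub>R ip x y"
  by (metis ip_smul_right sconj_of_real scaleR_conv_of_real smul_of_real)

lemma ip_minus_right: "ip x (- y) = - ip x y"
  using ip_scaleR_right[of x "-1" y] by simp

lemma ip_minus_left: "ip (- x) y = - ip x y"
  using ip_scaleR_left[of "-1" x y] by simp

lemma ip_diff_left: "ip (x - y) z = ip x z - ip y z"
  using ip_add_left[of x "- y" z] by (simp add: ip_minus_left)

lemma ip_diff_right: "ip x (y - z) = ip x y - ip x z"
  using ip_add_right[of x y "- z"] by (simp add: ip_minus_right)

lemma norm_ip_commute: "norm (ip x y) = norm (ip y x)"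
  by (metis ip_commute norm_sconj)

lemma norm_smul: "norm (smul c x) = norm c * norm x"
proof -
  have "of_real ((norm (smul c x))\<^sup>2) = (c * sconj c) * ip x x"
    by (simp add: ip_smul_left ip_smul_right ip_self[symmetric] del: of_real_power)
  also have "\<dots> = of_real ((norm c * norm x)\<^sup>2)"
    by (simp add: mult_sconj_of_real ip_self[of x] power_mult_distrib)
  finally have "(norm (smul c x))\<^sup>2 = (norm c * norm x)\<^sup>2"
    by (simp only: of_real_eq_iff)
  then show ?thesis
    by simp
qed

lemma Cauchy_Schwarz: "norm (ip x y) \<le> norm x * norm y"
proof (cases "y = 0")
  case True
  then show ?thesis
    using ip_scaleR_right[of x 0 y] by simp
next
  case False
  define c where "c = ip x y"
  \<comment> \<open>This is the component of \<open>x\<close> orthogonal to \<open>y\<close>, scaled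
    by the square of \<open>norm y\<close> to avoid division. Its squared norm is nonnegative, which
    is the claim.\<close>
  define z where "z = (norm y)\<^sup>2 *\<^sub>R x - smul c y"
  have yx: "ip y x = sconj c"
    unfolding c_def by (rule ip_commute)
  have cc: "sconj c * c = of_real ((norm c)\<^sup>2)"
    using mult_sconj_of_real[of c] by (simp add: mult.commute)
  have "ip z z = of_real ((norm y)\<^sup>2 * ((norm y)\<^sup>2 * (norm x)\<^sup>2))
      - of_real ((norm y)\<^sup>2) * (sconj c * c)
      - of_real ((norm y)\<^sup>2) * (c * sconj c) + c * sconj c * of_real ((norm y)\<^sup>2)"
    unfolding z_def
    by (simp add: ip_diff_left ip_diff_right ip_scaleR_left ip_scaleR_right ip_smul_left
        ip_smul_right ip_self[of x] ip_self[of y] yx scaleR_conv_of_real flip: c_def)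
      (simp add: algebra_simps)
  also have "\<dots> = of_real ((norm y)\<^sup>2 * ((norm y)\<^sup>2 * (norm x)\<^sup>2 - (norm c)\<^sup>2))"
    unfolding cc mult_sconj_of_real by (simp add: algebra_simps)
  finally have "(norm z)\<^sup>2 = (norm y)\<^sup>2 * ((norm y)\<^sup>2 * (norm x)\<^sup>2 - (norm c)\<^sup>2)"
    unfolding ip_self by (simp only: of_real_eq_iff)
  then have "0 \<le> (norm y)\<^sup>2 * ((norm y)\<^sup>2 * (norm x)\<^sup>2 - (norm c)\<^sup>2)"
    by (metis zero_le_power2)
  then have "(norm c)\<^sup>2 \<le> (norm x * norm y)\<^sup>2"
    using False by (simp add: zero_le_mult_iff power_mult_distrib mult.commute)
  then show ?thesis
    unfolding c_def by (rule power2_le_imp_le) simp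
qed

lemma bounded_linear_ip_left: "bounded_linear (\<lambda>x. ip x y)"
  by (rule bounded_linear_intro[where K = "norm y"])
    (simp_all add: ip_add_left ip_scaleR_left Cauchy_Schwarz)

lemma bounded_linear_ip_right: "bounded_linear (ip x)"
  by (rule bounded_linear_intro[where K = "norm x"])
    (use Cauchy_Schwarz[of x] in \<open>simp_all add: ip_add_right ip_scaleR_right mult.commute\<close>)

lemma bounded_linear_smul: "bounded_linear (smul c)"
proof (rule bounded_linear_intro[where K = "norm c"])
  show "smul c (r *\<^sub>R x) = r *\<^sub>R smul c x" for r x
    by (metis smul_of_real scale_scale mult.commute)
qed (simp_all add: scale_right_distrib norm_smul mult.commute)

lemma ip_sum_left: "ip (sum f F) y = (\<Sum>i\<in>F. ip (f i) y)"
  using bounded_linear_ip_left by (rule bounded_linear.linear[THEN linear_sum])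

text \<open>As \<open>r\<close> is real, both cross terms equal \<open>r\<close>. The contraction
  estimate in \<open>surj_S\<close> uses this with the real value from
  \<open>ip_S_self\<close>.\<close>

lemma norm_diff_power2:
  assumes "ip x y = of_real r"
  shows "(norm (x - y))\<^sup>2 = (norm x)\<^sup>2 - 2 * r + (norm y)\<^sup>2"
proof -
  have "ip y x = of_real r"
    using assms ip_commute[of y x] by simp
  then have "ip (x - y) (x - y) = of_real ((norm x)\<^sup>2 - 2 * r + (norm y)\<^sup>2)"
    by (simp add: ip_diff_left ip_diff_right ip_self[of x] ip_self[of y] assms)
  then show ?thesis
    unfolding ip_self by (simp only: of_real_eq_iff)
qed

end

section \<open>The frame operator and its inverse\<close>

locale frame = hilbert_space smul ip
  for smul :: "'k::scalar_field \<Rightarrow> 'h::banach \<Rightarrow> 'h" and ip :: "'h \<Rightarrow> 'h \<Rightarrow> 'k" +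
  fixes I :: "'i set" and \<phi> :: "'i \<Rightarrow> 'h" and A B :: real
  assumes frame: "frame_with_bounds ip I \<phi> A B"
begin

abbreviation S :: "'h \<Rightarrow> 'h" where
  "S \<equiv> frame_operator smul ip I \<phi>"

section \<open>Bounds for analysis and synthesis\<close>

lemma A_pos: "0 < A" and A_le_B: "A \<le> B" and B_pos: "0 < B"
  using frame by (auto simp: frame_with_bounds_def)

lemma analysis_l2: "l2 I (\<lambda>i. ip f (\<phi> i))"
  using frame by (simp add: frame_with_bounds_def l2_def)

lemma analysis_lower_power2: "A * (norm f)\<^sup>2 \<le> (l2norm I (\<lambda>i. ip f (\<phi> i)))\<^sup>2"
  using frame by (simp add: frame_with_bounds_def l2norm_power2)

lemma analysis_lower: "sqrt A * norm f \<le> l2norm I (\<lambda>i. ip f (\<phi> i))"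
  by (rule power2_le_imp_le)
    (use analysis_lower_power2[of f] A_pos in \<open>simp_all add: power_mult_distrib\<close>)

lemma analysis_upper: "l2norm I (\<lambda>i. ip f (\<phi> i)) \<le> sqrt B * norm f"
  by (rule power2_le_imp_le)
    (use frame B_pos in \<open>simp_all add: frame_with_bounds_def l2norm_power2 power_mult_distrib\<close>)

text \<open>Duality: pairing the sum \<open>v\<close> with itself brings in the frame coefficients
  of \<open>v\<close>, whose l2 norm is at most \<open>sqrt B * norm v\<close>. After Cauchy-Schwarz
  one factor \<open>norm v\<close> cancels.\<close>

lemma norm_finite_synthesis_le:
  assumes "finite F" "F \<subseteq> I"
  shows "norm (\<Sum>i\<in>F. smul (c i) (\<phi> i)) \<le> sqrt B * L2_set (\<lambda>i. norm (c i)) F"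
proof -
  define v where "v = (\<Sum>i\<in>F. smul (c i) (\<phi> i))"
  have "norm v * norm v = norm (ip v v)"
    by (simp add: ip_self power2_eq_square norm_mult)
  also have "ip v v = (\<Sum>i\<in>F. c i * ip (\<phi> i) v)"
    by (subst v_def, simp only: ip_sum_left ip_smul_left)
  also have "norm \<dots> \<le> (\<Sum>i\<in>F. \<bar>norm (c i)\<bar> * \<bar>norm (ip v (\<phi> i))\<bar>)"
    by (intro sum_norm_le) (simp add: norm_mult norm_ip_commute)
  also have "\<dots> \<le> L2_set (\<lambda>i. norm (c i)) F * L2_set (\<lambda>i. norm (ip v (\<phi> i))) F"
    by (rule L2_set_mult_ineq)
  also have "\<dots> \<le> L2_set (\<lambda>i. norm (c i)) F * (sqrt B * norm v)"
    using L2_set_le_l2norm[OF analysis_l2 assms, of v] analysis_upper[of v]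
    by (intro mult_left_mono) auto
  finally have "norm v * norm v \<le> (sqrt B * L2_set (\<lambda>i. norm (c i)) F) * norm v"
    by (simp add: mult_ac)
  then have "norm v \<le> sqrt B * L2_set (\<lambda>i. norm (c i)) F"
    using B_pos by (cases "v = 0") auto
  then show ?thesis
    by (simp only: v_def)
qed

lemma summable_synthesis:
  assumes "l2 I c"
  shows "(\<lambda>i. smul (c i) (\<phi> i)) summable_on I"
proof (rule summable_on_vanishing_tails)
  fix e :: real
  assume e: "e > 0"
  \<comment> \<open>Chosen so that \<open>sqrt B * sqrt \<delta>\<close> is \<open>e / 2\<close>;
    the factor one half turns the non-strict tail bound into a strict one.\<close>
  define \<delta> where "\<delta> = (e / 2)\<^sup>2 / B"
  have "\<delta> > 0"
    using e B_pos by (simp add: \<delta>_def)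
  then obtain G where G: "finite G" "G \<subseteq> I"
    and close: "dist (\<Sum>i\<in>G. (norm (c i))\<^sup>2) (\<Sum>\<^sub>\<infinity>i\<in>I. (norm (c i))\<^sup>2) \<le> \<delta>"
    using infsum_finite_approximation[OF assms[unfolded l2_def]] by blast
  have "norm (\<Sum>i\<in>F. smul (c i) (\<phi> i)) < e" if F: "finite F" "F \<subseteq> I - G" for F
  proof -
    \<comment> \<open>\<open>G\<close> carries all but \<open>\<delta>\<close> of the total square
      sum, so a disjoint \<open>F\<close> has at most \<open>\<delta>\<close> left.\<close>
    have "(\<Sum>i\<in>G \<union> F. (norm (c i))\<^sup>2) \<le> (\<Sum>\<^sub>\<infinity>i\<in>I. (norm (c i))\<^sup>2)"
      using assms F G by (intro finite_sum_le_infsum) (auto simp: l2_def)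
    moreover have "(\<Sum>i\<in>G \<union> F. (norm (c i))\<^sup>2) = (\<Sum>i\<in>G. (norm (c i))\<^sup>2) + (\<Sum>i\<in>F. (norm (c i))\<^sup>2)"
      using F G by (intro sum.union_disjoint) auto
    ultimately have "(\<Sum>i\<in>F. (norm (c i))\<^sup>2) \<le> \<delta>"
      using close by (auto simp: dist_real_def)
    then have "L2_set (\<lambda>i. norm (c i)) F \<le> sqrt \<delta>"
      by (simp add: L2_set_def)
    then have "sqrt B * L2_set (\<lambda>i. norm (c i)) F \<le> sqrt B * sqrt \<delta>"
      using B_pos by simp
    also have "sqrt B * sqrt \<delta> = e / 2"
      using e B_pos by (simp add: \<delta>_def real_sqrt_divide)
    finally have "sqrt B * L2_set (\<lambda>i. norm (c i)) F \<le> e / 2" .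
    moreover have "norm (\<Sum>i\<in>F. smul (c i) (\<phi> i)) \<le> sqrt B * L2_set (\<lambda>i. norm (c i)) F"
      using F by (intro norm_finite_synthesis_le) auto
    ultimately show ?thesis
      using e by linarith
  qed
  with G show "\<exists>G. finite G \<and> G \<subseteq> I \<and>
      (\<forall>F. finite F \<longrightarrow> F \<subseteq> I - G \<longrightarrow> norm (\<Sum>i\<in>F. smul (c i) (\<phi> i)) < e)"
    by blast
qed

lemma norm_synthesis_le:
  assumes "l2 I c" "((\<lambda>i. smul (c i) (\<phi> i)) has_sum v) I"
  shows "norm v \<le> sqrt B * l2norm I c"
proof (rule tendsto_upperbound)
  show "((\<lambda>F. norm (\<Sum>i\<in>F. smul (c i) (\<phi> i))) \<longlongrightarrow> norm v) (finite_subsets_at_top I)"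
    using assms(2) unfolding has_sum_def by (rule tendsto_norm)
  have "norm (\<Sum>i\<in>F. smul (c i) (\<phi> i)) \<le> sqrt B * l2norm I c" if "finite F" "F \<subseteq> I" for F
  proof -
    have "sqrt B * L2_set (\<lambda>i. norm (c i)) F \<le> sqrt B * l2norm I c"
      using L2_set_le_l2norm[OF assms(1) that] B_pos by simp
    then show ?thesis
      using norm_finite_synthesis_le[OF that, of c] by linarith
  qed
  then show "\<forall>\<^sub>F F in finite_subsets_at_top I. norm (\<Sum>i\<in>F. smul (c i) (\<phi> i)) \<le> sqrt B * l2norm I c"
    by (rule eventually_finite_subsets_at_top_weakI)
qed simp

section \<open>Boundedness, symmetry and bijectivity of the frame operator\<close>

lemma S_has_sum: "((\<lambda>i. smul (ip f (\<phi> i)) (\<phi> i)) has_sum S f) I"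
  unfolding frame_operator_def by (intro has_sum_infsum summable_synthesis analysis_l2)

lemma norm_S_le: "norm (S f) \<le> B * norm f"
proof -
  have "norm (S f) \<le> sqrt B * l2norm I (\<lambda>i. ip f (\<phi> i))"
    by (rule norm_synthesis_le[OF analysis_l2 S_has_sum])
  also have "\<dots> \<le> sqrt B * (sqrt B * norm f)"
    using B_pos by (intro mult_left_mono analysis_upper) simp
  finally have "norm (S f) \<le> sqrt B * (sqrt B * norm f)" .
  then show ?thesis
    using B_pos by (simp flip: mult.assoc)
qed

lemma S_add: "S (f + g) = S f + S g"
proof -
  have "((\<lambda>i. smul (ip (f + g) (\<phi> i)) (\<phi> i)) has_sum (S f + S g)) I"
    using has_sum_add[OF S_has_sum[of f] S_has_sum[of g]]
    by (simp add: ip_add_left scale_left_distrib)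
  then show ?thesis
    using S_has_sum has_sum_unique by blast
qed

lemma S_scaleR: "S (r *\<^sub>R f) = r *\<^sub>R S f"
proof -
  have "smul (ip (r *\<^sub>R f) (\<phi> i)) (\<phi> i) = r *\<^sub>R smul (ip f (\<phi> i)) (\<phi> i)" for i
    unfolding smul_of_real[symmetric] ip_smul_left scale_scale ..
  then have "((\<lambda>i. smul (ip (r *\<^sub>R f) (\<phi> i)) (\<phi> i)) has_sum (r *\<^sub>R S f)) I"
    using has_sum_bounded_linear[OF bounded_linear_scaleR_right S_has_sum] by simp
  then show ?thesis
    using S_has_sum has_sum_unique by blast
qed

lemma linear_S: "linear S"
  by (rule linearI) (simp_all add: S_add S_scaleR)

text \<open>Expanding \<open>S\<close> on either side gives the same scalar series, by conjugate
  symmetry of \<open>ip\<close>.\<close>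

lemma S_self_adjoint: "ip (S f) g = ip f (S g)"
proof -
  have "((\<lambda>i. ip f (\<phi> i) * ip (\<phi> i) g) has_sum ip (S f) g) I"
    using has_sum_bounded_linear[OF bounded_linear_ip_left S_has_sum] by (simp add: ip_smul_left)
  moreover have "((\<lambda>i. ip f (\<phi> i) * ip (\<phi> i) g) has_sum ip f (S g)) I"
    using has_sum_bounded_linear[OF bounded_linear_ip_right S_has_sum, of f g]
    by (simp add: ip_smul_right mult.commute flip: ip_commute)
  ultimately show ?thesis
    by (rule has_sum_unique)
qed

lemma ip_S_self: "ip f (S f) = of_real ((l2norm I (\<lambda>i. ip f (\<phi> i)))\<^sup>2)"
proof -
  have "((\<lambda>i. ip f (\<phi> i) * ip (\<phi> i) f) has_sum ip (S f) f) I"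
    using has_sum_bounded_linear[OF bounded_linear_ip_left S_has_sum] by (simp add: ip_smul_left)
  moreover have "ip f (\<phi> i) * ip (\<phi> i) f = of_real ((norm (ip f (\<phi> i)))\<^sup>2)" for i
    using ip_commute[of "\<phi> i" f] mult_sconj_of_real by simp
  ultimately have "((\<lambda>i. of_real ((norm (ip f (\<phi> i)))\<^sup>2)) has_sum ip (S f) f) I"
    by simp
  moreover have "((\<lambda>i. of_real ((norm (ip f (\<phi> i)))\<^sup>2)) has_sum
      (of_real ((l2norm I (\<lambda>i. ip f (\<phi> i)))\<^sup>2) :: 'k)) I"
    unfolding l2norm_power2
    by (intro has_sum_of_real has_sum_infsum analysis_l2[unfolded l2_def])
  ultimately show ?thesis
    using has_sum_unique S_self_adjoint by metis
qed

text \<open>The lower frame bound is a lower bound for the quadratic form of \<open>S\<close>, and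
  Cauchy-Schwarz bounds that form by \<open>norm f * norm (S f)\<close>. Injectivity and boundedness
  of the inverse both rest on this.\<close>

lemma norm_S_ge: "A * norm f \<le> norm (S f)"
proof (cases "f = 0")
  case False
  have "A * (norm f)\<^sup>2 \<le> norm (ip f (S f))"
    using analysis_lower_power2[of f] by (simp add: ip_S_self norm_power)
  also have "\<dots> \<le> norm f * norm (S f)"
    by (rule Cauchy_Schwarz)
  finally show ?thesis
    using False by (simp add: power2_eq_square mult_ac)
qed simp

lemma inj_S: "inj S"
proof (rule injI)
  fix x y
  assume "S x = S y"
  then have "A * norm (x - y) \<le> 0"
    using norm_S_ge[of "x - y"] linear_S by (simp add: linear_diff)
  then show "x = y"
    using A_pos by (simp add: mult_le_0_iff)
qed

text \<open>
  A solution of \<open>S x = g\<close> is a fixed point of \<open>x \<mapsto> x - \<tau> (S x - g)\<close>, which contracts because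
  \<open>\<parallel>f - \<tau> S f\<parallel>\<^sup>2 \<le> (1 - 2 \<tau> A + \<tau>\<^sup>2 B\<^sup>2) \<parallel>f\<parallel>\<^sup>2\<close>; the choice \<open>\<tau> = A / B\<^sup>2\<close> minimises the factor.
\<close>

lemma surj_S: "surj S"
proof -
  define \<tau> where "\<tau> = A / B\<^sup>2"
  define q where "q = 1 - (A / B)\<^sup>2"
  have \<tau>: "0 \<le> \<tau>"
    using A_pos by (simp add: \<tau>_def)
  have AB: "0 < A / B" "A / B \<le> 1"
    using A_pos B_pos A_le_B by auto
  then have q: "0 \<le> q" "q < 1"
    unfolding q_def by (auto simp: power_le_one)
  have contract: "norm (f - \<tau> *\<^sub>R S f) \<le> sqrt q * norm f" for f
  proof (rule power2_le_imp_le)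
    define a where "a = (l2norm I (\<lambda>i. ip f (\<phi> i)))\<^sup>2"
    have "ip f (\<tau> *\<^sub>R S f) = of_real (\<tau> * a)"
      by (simp add: ip_scaleR_right ip_S_self a_def scaleR_conv_of_real)
    then have "(norm (f - \<tau> *\<^sub>R S f))\<^sup>2 = (norm f)\<^sup>2 - 2 * (\<tau> * a) + (norm (\<tau> *\<^sub>R S f))\<^sup>2"
      by (rule norm_diff_power2)
    also have "\<dots> \<le> (norm f)\<^sup>2 - 2 * (\<tau> * (A * (norm f)\<^sup>2)) + (\<tau> * (B * norm f))\<^sup>2"
    proof -
      have "\<tau> * (A * (norm f)\<^sup>2) \<le> \<tau> * a"
        unfolding a_def by (intro mult_left_mono analysis_lower_power2 \<tau>)
      moreover have "(norm (\<tau> *\<^sub>R S f))\<^sup>2 \<le> (\<tau> * (B * norm f))\<^sup>2"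
        using \<tau> norm_S_le[of f] by (intro power_mono) (auto intro: mult_left_mono)
      ultimately show ?thesis
        by linarith
    qed
    also have "\<dots> = q * (norm f)\<^sup>2"
      using B_pos by (simp add: \<tau>_def q_def field_simps power2_eq_square)
    finally show "(norm (f - \<tau> *\<^sub>R S f))\<^sup>2 \<le> (sqrt q * norm f)\<^sup>2"
      using q by (simp add: power_mult_distrib)
  qed (use q in simp)
  have "\<exists>x. S x = g" for g
  proof -
    define h where "h x = x - \<tau> *\<^sub>R (S x - g)" for x
    have "h x - h y = (x - y) - \<tau> *\<^sub>R S (x - y)" for x y
      using linear_S by (simp add: h_def linear_diff algebra_simps)
    then have "dist (h x) (h y) \<le> sqrt q * dist x y" for x y
      using contract[of "x - y"] by (simp add: dist_norm)
    then obtain x where "h x = x"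
      using banach_fix_type[of "sqrt q" h] q by auto
    moreover have "\<tau> \<noteq> 0"
      using A_pos B_pos by (simp add: \<tau>_def)
    ultimately show ?thesis
      by (auto simp: h_def)
  qed
  then show ?thesis
    by (metis surjI)
qed

section \<open>The inverse frame operator and the synthesis kernel\<close>

abbreviation R :: "'h \<Rightarrow> 'h" where
  "R \<equiv> inv S"

lemma S_R [simp]: "S (R f) = f"
  using surj_S by (rule surj_f_inv_f)

lemma R_self_adjoint: "ip (R f) g = ip f (R g)"
  using S_self_adjoint[of "R f" "R g"] by simp

lemma norm_R_le: "A * norm (R f) \<le> norm f"
  using norm_S_ge[of "R f"] by simp

lemma bounded_linear_R: "bounded_linear R"
proof (rule bounded_linear_intro[where K = "1 / A"])
  show "R (f + g) = R f + R g" for f g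
    using inj_S by (rule injD) (simp add: S_add)
  show "R (r *\<^sub>R f) = r *\<^sub>R R f" for r f
    using inj_S by (rule injD) (simp add: S_scaleR)
  show "norm (R f) \<le> norm f * (1 / A)" for f
    using norm_R_le[of f] A_pos by (simp add: field_simps)
qed

text \<open>Reconstruction by the canonical dual \<open>R (\<phi> i)\<close>, with \<open>R\<close>
  moved to the other argument by self-adjointness.\<close>

lemma R_has_sum: "((\<lambda>i. smul (ip (R f) (\<phi> i)) (\<phi> i)) has_sum f) I"
  using S_has_sum[of "R f"] by simp

text \<open>
  \<open>R\<close> yields the right inverse \<open>v \<mapsto> (\<langle>R v, \<phi>\<^sub>i\<rangle>)\<^sub>i\<close> of the synthesis operator. If the latter were
  injective, it would be a two-sided inverse, and the lower Riesz bound would follow.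
\<close>

lemma synthesis_kernel_nontrivial:
  assumes "\<not> riesz_basis smul I \<phi>"
  obtains d j where "l2 I d" "((\<lambda>i. smul (d i) (\<phi> i)) has_sum 0) I" "j \<in> I" "d j \<noteq> 0"
proof (rule ccontr)
  assume "\<not> thesis"
  then have kernel: "\<And>d j. l2 I d \<Longrightarrow> ((\<lambda>i. smul (d i) (\<phi> i)) has_sum 0) I \<Longrightarrow> j \<in> I \<Longrightarrow> d j = 0"
    using that by blast
  \<comment> \<open>Completeness: the partial sums of the reconstruction series lie in the
    span.\<close>
  have "f \<in> closure (span (\<phi> ` I))" for f
  proof (rule Lim_in_closed_set)
    show "(sum (\<lambda>i. smul (ip (R f) (\<phi> i)) (\<phi> i)) \<longlongrightarrow> f) (finite_subsets_at_top I)"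
      using R_has_sum[of f] by (simp add: has_sum_def)
    show "\<forall>\<^sub>F F in finite_subsets_at_top I.
        (\<Sum>i\<in>F. smul (ip (R f) (\<phi> i)) (\<phi> i)) \<in> closure (span (\<phi> ` I))"
      by (intro eventually_finite_subsets_at_top_weakI subsetD[OF closure_subset]
          span_sum span_scale span_base) auto
  qed simp_all
  then have "closure (span (\<phi> ` I)) = UNIV"
    by blast
  \<comment> \<open>The lower constant combines two estimates: the square sum of \<open>c\<close> is
    at most \<open>B\<close> times the square of \<open>norm (R v)\<close>, and
    \<open>A * norm (R v)\<close> is at most \<open>norm v\<close>.\<close>
  moreover have "A\<^sup>2 / B * (\<Sum>i\<in>F. (norm (c i))\<^sup>2) \<le> (norm (\<Sum>i\<in>F. smul (c i) (\<phi> i)))\<^sup>2 \<and>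
      (norm (\<Sum>i\<in>F. smul (c i) (\<phi> i)))\<^sup>2 \<le> B * (\<Sum>i\<in>F. (norm (c i))\<^sup>2)"
    if F: "finite F" "F \<subseteq> I" for F c
  proof
    define v where "v = (\<Sum>i\<in>F. smul (c i) (\<phi> i))"
    define e where "e i = (if i \<in> F then c i else 0)" for i
    \<comment> \<open>Both \<open>e\<close> and the coefficients of \<open>R v\<close> synthesize
      \<open>v\<close>, so their difference lies in the kernel and must vanish on
      \<open>I\<close>.\<close>
    define d where "d i = e i + (-1) * ip (R v) (\<phi> i)" for i
    have e_sum: "((\<lambda>i. smul (e i) (\<phi> i)) has_sum v) I"
      using F by (intro has_sum_finite_neutralI) (auto simp: e_def v_def)
    have e_l2: "l2 I e"
      unfolding l2_def summable_on_def using F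
      by (intro exI[of _ "\<Sum>i\<in>F. (norm (c i))\<^sup>2"] has_sum_finite_neutralI) (auto simp: e_def)
    have "l2 I d"
      unfolding d_def by (intro l2_add l2_scale e_l2 analysis_l2)
    moreover have "((\<lambda>i. smul (d i) (\<phi> i)) has_sum 0) I"
      using has_sum_add[OF e_sum has_sum_bounded_linear[OF bounded_linear_smul[of "-1"] R_has_sum[of v]]]
      by (simp add: d_def scale_left_diff_distrib)
    ultimately have "d i = 0" if "i \<in> I" for i
      using kernel that by blast
    then have c: "c i = ip (R v) (\<phi> i)" if "i \<in> F" for i
      using that F by (force simp: d_def e_def)
    have "(\<Sum>i\<in>F. (norm (c i))\<^sup>2) = (\<Sum>i\<in>F. (norm (ip (R v) (\<phi> i)))\<^sup>2)"
      using c by simp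
    also have "\<dots> \<le> (\<Sum>\<^sub>\<infinity>i\<in>I. (norm (ip (R v) (\<phi> i)))\<^sup>2)"
      using analysis_l2[of "R v"] F by (intro finite_sum_le_infsum) (auto simp: l2_def)
    also have "\<dots> \<le> (sqrt B * norm (R v))\<^sup>2"
      unfolding l2norm_power2[symmetric] by (intro power_mono analysis_upper) simp
    finally have "A\<^sup>2 / B * (\<Sum>i\<in>F. (norm (c i))\<^sup>2) \<le> A\<^sup>2 / B * (sqrt B * norm (R v))\<^sup>2"
      using A_pos B_pos by (intro mult_left_mono) auto
    also have "\<dots> = (A * norm (R v))\<^sup>2"
      using B_pos by (simp add: power_mult_distrib)
    also have "\<dots> \<le> (norm v)\<^sup>2"
      using A_pos by (intro power_mono norm_R_le) simp
    finally show "A\<^sup>2 / B * (\<Sum>i\<in>F. (norm (c i))\<^sup>2) \<le> (norm (\<Sum>i\<in>F. smul (c i) (\<phi> i)))\<^sup>2"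
      by (simp only: v_def)
    have "(norm v)\<^sup>2 \<le> (sqrt B * L2_set (\<lambda>i. norm (c i)) F)\<^sup>2"
      unfolding v_def by (intro power_mono norm_finite_synthesis_le F) simp
    then show "(norm (\<Sum>i\<in>F. smul (c i) (\<phi> i)))\<^sup>2 \<le> B * (\<Sum>i\<in>F. (norm (c i))\<^sup>2)"
      using B_pos by (simp add: v_def power_mult_distrib L2_set_def sum_nonneg)
  qed
  moreover have "0 < A\<^sup>2 / B" "A\<^sup>2 / B \<le> B"
    using A_pos B_pos A_le_B by (simp_all add: divide_le_eq power_mono flip: power2_eq_square)
  ultimately have "riesz_basis smul I \<phi>"
    unfolding riesz_basis_def by blast
  with assms show False ..
qed

section \<open>Perturbed canonical duals\<close>

text \<open>The conjugate cancels the conjugate-linearity of \<open>ip\<close> in its second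
  argument, so that \<open>d\<close> itself enters the coefficients. Restriction to \<open>I\<close>
  fixes the irrelevant values outside, so that distinct functions are distinct families.\<close>

definition perturbed_dual :: "('i \<Rightarrow> 'k) \<Rightarrow> 'h \<Rightarrow> real \<Rightarrow> 'i \<Rightarrow> 'h" where
  "perturbed_dual d h t = (\<lambda>i\<in>I. R (\<phi> i) + t *\<^sub>R smul (sconj (d i)) h)"

lemma ip_perturbed_dual:
  assumes "i \<in> I"
  shows "ip f (perturbed_dual d h t i) = ip (R f) (\<phi> i) + (of_real t * ip f h) * d i"
  using assms
  by (simp add: perturbed_dual_def ip_add_right ip_scaleR_right ip_smul_right R_self_adjoint
      scaleR_conv_of_real)

text \<open>The perturbation contributes a scalar multiple of the synthesis of \<open>d\<close>,
  which is 0; reconstruction by the canonical dual remains.\<close>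

lemma perturbed_dual_has_sum:
  assumes "((\<lambda>i. smul (d i) (\<phi> i)) has_sum 0) I"
  shows "((\<lambda>i. smul (ip f (perturbed_dual d h t i)) (\<phi> i)) has_sum f) I"
proof -
  define k where "k = of_real t * ip f h"
  have "((\<lambda>i. smul (ip (R f) (\<phi> i)) (\<phi> i) + smul k (smul (d i) (\<phi> i))) has_sum (f + smul k 0)) I"
    by (intro has_sum_add R_has_sum has_sum_bounded_linear[OF bounded_linear_smul assms])
  then show ?thesis
    by (subst has_sum_cong[where g = "\<lambda>i. smul (ip (R f) (\<phi> i)) (\<phi> i) + smul k (smul (d i) (\<phi> i))"])
      (simp_all add: ip_perturbed_dual scale_left_distrib k_def)
qed

text \<open>
  The coefficients of \<open>f\<close> in a weaving differ from \<open>\<langle>f, \<phi>\<^sub>i\<rangle>\<close> only outside \<open>J\<close>, and there by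
  \<open>\<langle>f - R f, \<phi>\<^sub>i\<rangle>\<close> plus the perturbation.
\<close>

lemma weaving_frame:
  assumes d: "l2 I d"
    and small: "sqrt B * onorm (\<lambda>f. f - R f) + \<bar>t\<bar> * norm h * l2norm I d < sqrt A" (is "?C < _")
  shows "frame_with_bounds ip I (\<lambda>i. if i \<in> J then \<phi> i else perturbed_dual d h t i)
    ((sqrt A - ?C)\<^sup>2) ((sqrt B + ?C)\<^sup>2)"
proof -
  let ?\<epsilon> = "onorm (\<lambda>f. f - R f)"
  let ?w = "\<lambda>f i. ip f (if i \<in> J then \<phi> i else perturbed_dual d h t i)"
  \<comment> \<open>Boundedness makes \<open>onorm\<close> a genuine bound and not the supremum of a
    possibly unbounded set.\<close>
  have bl: "bounded_linear (\<lambda>f. f - R f)"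
    by (intro bounded_linear_sub bounded_linear_ident bounded_linear_R)
  have C: "0 \<le> ?C"
    using onorm_pos_le[OF bl] B_pos by simp
  have key: "l2 I (?w f) \<and> (sqrt A - ?C) * norm f \<le> l2norm I (?w f) \<and>
    l2norm I (?w f) \<le> (sqrt B + ?C) * norm f" for f
  proof -
    define k where "k = of_real t * ip f h"
    define u where "u i = (if i \<in> J then 0 else ip (f - R f) (\<phi> i) + (- k) * d i)" for i
    have w: "?w f i = ip f (\<phi> i) + (-1) * u i" and a: "ip f (\<phi> i) = ?w f i + u i"
      if "i \<in> I" for i
      using that by (auto simp: u_def k_def ip_perturbed_dual ip_diff_left)
    let ?v = "\<lambda>i. ip (f - R f) (\<phi> i) + (- k) * d i"
    have v_l2: "l2 I ?v"
      by (intro l2_add l2_scale d analysis_l2)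
    \<comment> \<open>The dominating family does not involve \<open>J\<close>, which makes the bound
      on \<open>u\<close> uniform over all weavings.\<close>
    have u_l2: "l2 I u" "l2norm I u \<le> l2norm I ?v"
      by (rule l2_dominated[OF v_l2]; simp add: u_def)+
    have "l2norm I ?v \<le> l2norm I (\<lambda>i. ip (f - R f) (\<phi> i)) + l2norm I (\<lambda>i. (- k) * d i)"
      by (intro l2_add l2_scale d analysis_l2)
    also have "l2norm I (\<lambda>i. (- k) * d i) = norm k * l2norm I d"
      using l2_scale(2)[OF d, of "- k"] by simp
    also have "norm k * l2norm I d \<le> \<bar>t\<bar> * (norm f * norm h) * l2norm I d"
      by (intro mult_right_mono) (auto simp: k_def norm_mult intro!: mult_left_mono Cauchy_Schwarz)
    also have "l2norm I (\<lambda>i. ip (f - R f) (\<phi> i)) \<le> sqrt B * norm (f - R f)"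
      by (rule analysis_upper)
    also have "\<dots> \<le> sqrt B * (?\<epsilon> * norm f)"
      using onorm[OF bl, of f] B_pos by simp
    finally have u_norm: "l2norm I u \<le> ?C * norm f"
      using u_l2(2) by (simp add: algebra_simps)
    have w_l2: "l2 I (?w f)"
      using l2_add(1)[OF analysis_l2 l2_scale(1)[OF u_l2(1), of "-1"], of f]
      by (subst l2_cong[OF w]) simp_all
    have "l2norm I (?w f) = l2norm I (\<lambda>i. ip f (\<phi> i) + (-1) * u i)"
      by (rule l2norm_cong[OF w])
    also have "\<dots> \<le> l2norm I (\<lambda>i. ip f (\<phi> i)) + l2norm I (\<lambda>i. (-1) * u i)"
      by (intro l2_add analysis_l2 l2_scale u_l2)
    also have "l2norm I (\<lambda>i. (-1) * u i) = l2norm I u"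
      using l2_scale(2)[OF u_l2(1), of "-1"] by simp
    finally have upper: "l2norm I (?w f) \<le> (sqrt B + ?C) * norm f"
      using analysis_upper[of f] u_norm by (simp add: algebra_simps)
    \<comment> \<open>Reverse triangle inequality: the coefficients for \<open>\<phi>\<close> are
      those of the weaving plus \<open>u\<close>, and \<open>u\<close> costs at most
      \<open>?C * norm f\<close>.\<close>
    have "sqrt A * norm f \<le> l2norm I (\<lambda>i. ip f (\<phi> i))"
      by (rule analysis_lower)
    also have "\<dots> = l2norm I (\<lambda>i. ?w f i + u i)"
      by (rule l2norm_cong[OF a])
    also have "\<dots> \<le> l2norm I (?w f) + l2norm I u"
      by (intro l2_add w_l2 u_l2)
    finally have "(sqrt A - ?C) * norm f \<le> l2norm I (?w f)"
      using u_norm by (simp add: algebra_simps)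
    with upper w_l2 show ?thesis
      by blast
  qed
  have "sqrt A \<le> sqrt B"
    using A_le_B by simp
  with C have "sqrt A - ?C \<le> sqrt B + ?C"
    by linarith
  with small key show ?thesis
    by (intro frame_with_bounds_l2) auto
qed

lemma perturbed_dual_woven:
  assumes "l2 I d" "((\<lambda>i. smul (d i) (\<phi> i)) has_sum 0) I"
    and "sqrt B * onorm (\<lambda>f. f - R f) + \<bar>t\<bar> * norm h * l2norm I d < sqrt A"
  shows "dual_frame smul ip I \<phi> (perturbed_dual d h t)" "woven ip I \<phi> (perturbed_dual d h t)"
proof -
  note weaving = weaving_frame[OF assms(1,3)]
  \<comment> \<open>The weaving with empty \<open>J\<close> is the perturbed dual itself.\<close>
  have \<psi>: "is_frame ip I (perturbed_dual d h t)"
    unfolding is_frame_def using weaving[of "{}"] by simp blast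
  have \<phi>: "is_frame ip I \<phi>"
    unfolding is_frame_def by (intro exI) (rule frame)
  show "dual_frame smul ip I \<phi> (perturbed_dual d h t)"
    unfolding dual_frame_def by (intro conjI allI \<psi> perturbed_dual_has_sum assms)
  show "woven ip I \<phi> (perturbed_dual d h t)"
    unfolding woven_def by (intro conjI exI allI impI \<phi> \<psi>) (rule weaving)
qed

text \<open>Evaluation at \<open>j\<close>, where the perturbation direction is a nonzero vector,
  recovers the parameter.\<close>

lemma inj_perturbed_dual:
  assumes "j \<in> I" "d j \<noteq> 0" "h \<noteq> 0"
  shows "inj (perturbed_dual d h)"
proof (rule injI)
  fix s t
  assume "perturbed_dual d h s = perturbed_dual d h t"
  from fun_cong[OF this, of j] have "s *\<^sub>R smul (sconj (d j)) h = t *\<^sub>R smul (sconj (d j)) h"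
    using assms by (simp add: perturbed_dual_def)
  moreover have "smul (sconj (d j)) h \<noteq> 0"
    using assms(2,3) norm_smul[of "sconj (d j)" h] by force
  ultimately show "s = t"
    by simp
qed

end

theorem theorem3p1:
  fixes smul :: "'k::scalar_field \<Rightarrow> 'h::banach \<Rightarrow> 'h"
    and ip :: "'h \<Rightarrow> 'h \<Rightarrow> 'k"
    and I :: "'i set"
    and \<phi> :: "'i \<Rightarrow> 'h"
    and A B :: real
  assumes "hilbert_space smul ip"
    and "separable_space (euclidean :: 'h topology)"
    and "\<exists>f::'h. f \<noteq> 0"
    and "countable I"
    and "redundant_frame smul ip I \<phi>"
    and "frame_with_bounds ip I \<phi> A B"
    and "(onorm (\<lambda>f. f - inv (frame_operator smul ip I \<phi>) f))\<^sup>2 < A / B"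
  shows "infinite {\<psi> \<in> I \<rightarrow>\<^sub>E UNIV. dual_frame smul ip I \<phi> \<psi> \<and> woven ip I \<phi> \<psi>}"
    (is "infinite ?D")
proof -
  interpret frame smul ip I \<phi> A B
    using assms(1,6) by (simp add: frame_def frame_axioms_def)
  obtain h :: 'h where h: "h \<noteq> 0"
    using assms(3) by blast
  have "\<not> riesz_basis smul I \<phi>"
    using assms(5) by (simp add: redundant_frame_def)
  then obtain d j where d: "l2 I d" "((\<lambda>i. smul (d i) (\<phi> i)) has_sum 0) I" "j \<in> I" "d j \<noteq> 0"
    by (rule synthesis_kernel_nontrivial)
  define \<delta> where "\<delta> = sqrt A - sqrt B * onorm (\<lambda>f. f - R f)"
  \<comment> \<open>Below \<open>t\<^sub>0\<close> the perturbation costs less than the gap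
    \<open>\<delta>\<close>. The summand 1 keeps the denominator positive and makes the cost
    estimate a plain multiplication.\<close>
  define t\<^sub>0 where "t\<^sub>0 = \<delta> / (norm h * l2norm I d + 1)"
  \<comment> \<open>The norm hypothesis multiplied by \<open>B\<close>; its square root says that
    the gap \<open>\<delta>\<close> is positive.\<close>
  have "(sqrt B * onorm (\<lambda>f. f - R f))\<^sup>2 < A"
    using assms(7) B_pos by (simp add: power_mult_distrib field_simps)
  then have "\<delta> > 0"
    unfolding \<delta>_def using real_less_rsqrt[of "sqrt B * onorm (\<lambda>f. f - R f)" A] by simp
  moreover have pos: "0 < norm h * l2norm I d + 1"
    by (simp add: add_nonneg_pos)
  ultimately have "0 < t\<^sub>0"
    by (simp add: t\<^sub>0_def)
  \<comment> \<open>An interval of parameters is infinite, and distinct parameters give distinct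
    duals since \<open>d j\<close> and \<open>h\<close> are nonzero.\<close>
  then have "infinite (perturbed_dual d h ` {0<..<t\<^sub>0})"
    using inj_perturbed_dual[of j d h] d h by (simp add: finite_image_iff inj_on_subset)
  moreover have "perturbed_dual d h t \<in> ?D" if "0 < t" "t < t\<^sub>0" for t
  proof -
    have "t * (norm h * l2norm I d + 1) < \<delta>"
      using that pos by (simp add: t\<^sub>0_def pos_less_divide_eq)
    then have "sqrt B * onorm (\<lambda>f. f - R f) + \<bar>t\<bar> * norm h * l2norm I d < sqrt A"
      using that by (simp add: \<delta>_def algebra_simps)
    then show ?thesis
      using perturbed_dual_woven[OF d(1,2)] by (auto simp: perturbed_dual_def)
  qed
  ultimately show ?thesis
    by (meson finite_subset greaterThanLessThan_iff image_subsetI)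
qed

end
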